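(* For any $\varepsilon\in(0,1)$, choosing $$\Delta=\overline{L}+\sigma\sqrt{\frac{1-\varepsilon}{\varepsilon}}$$ guarantees $\mathbb{P}(L_j>\Delta)\le\varepsilon$. Hence, with probability at least $1-\varepsilon$, each truck arrives when the loader is free.
   Context: A single loader serves trucks scheduled deterministically every $\Delta>0$ minutes (a $D/G/1$ queue under first-in-first-out service). $L_j$ is the random loading time of the $j$th truck, with mean $\mathbb{E}[L_j]=\overline{L}>0$ and variance $\mathrm{Var}(L_j)=\sigma^2<\infty$, $\sigma$ being the standard deviation; no further distributional assumption is made. The waiting time $W_j(\Delta)$ of the $j$th truck is given by Lindley's recursion $W_1(\Delta)=0$, $W_{j+1}(\Delta)=\max\{0,\,W_j(\Delta)+L_j-\Delta\}$. A truck arrives when the loader is free if, at its arrival, the loader is not still busy with earlier trucks; $\varepsilon$ is the tolerated maximum probability that a truck arrives while the loader is still busy. *)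

theory Defs
  imports "HOL-Probability.Probability"
begin

text \<open>
  Trucks are numbered from \<open>0\<close>, so truck \<open>j\<close> here is the \<open>(j+1)\<close>-st truck, and it arrives at
  time \<open>j \<cdot> \<Delta>\<close>. A sequence \<open>l\<close> stands for one realisation of the loading times.
\<close>

primrec waiting_time :: "real \<Rightarrow> (nat \<Rightarrow> real) \<Rightarrow> nat \<Rightarrow> real" where
  "waiting_time \<Delta> l 0 = 0"
| "waiting_time \<Delta> l (Suc j) = max 0 (waiting_time \<Delta> l j + l j - \<Delta>)"

definition arrival_time :: "real \<Rightarrow> nat \<Rightarrow> real" where
  "arrival_time \<Delta> j = real j * \<Delta>"

definition departure_time :: "real \<Rightarrow> (nat \<Rightarrow> real) \<Rightarrow> nat \<Rightarrow> real" where
  "departure_time \<Delta> l j = arrival_time \<Delta> j + waiting_time \<Delta> l j + l j"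

text \<open>
  A truck that arrives at the very instant at which the previous one is finished finds the
  loader free.
\<close>

definition arrives_when_free :: "real \<Rightarrow> (nat \<Rightarrow> real) \<Rightarrow> nat \<Rightarrow> bool" where
  "arrives_when_free \<Delta> l j \<longleftrightarrow> (\<forall>i<j. departure_time \<Delta> l i \<le> arrival_time \<Delta> j)"

text \<open>
  For nonnegative loading times, this is the same as not having to wait.
\<close>

lemma departure_time_Suc:
  "departure_time \<Delta> l (Suc j) =
     max (arrival_time \<Delta> (Suc j)) (departure_time \<Delta> l j) + l (Suc j)"
  by (simp add: departure_time_def arrival_time_def algebra_simps max_def)

lemma departure_time_mono:
  assumes "\<And>i. 0 \<le> l i" and "i \<le> j"
  shows "departure_time \<Delta> l i \<le> departure_time \<Delta> l j"
  using assms(2)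
proof (rule lift_Suc_mono_le[rotated])
  show "departure_time \<Delta> l n \<le> departure_time \<Delta> l (Suc n)" for n
    using assms(1)[of "Suc n"] by (simp add: departure_time_Suc)
qed

lemma arrives_when_free_iff:
  assumes "\<And>i. 0 \<le> l i"
  shows "arrives_when_free \<Delta> l j \<longleftrightarrow> waiting_time \<Delta> l j = 0"
proof (cases j)
  case 0
  then show ?thesis by (simp add: arrives_when_free_def)
next
  case (Suc k)
  have "arrives_when_free \<Delta> l j \<longleftrightarrow> departure_time \<Delta> l k \<le> arrival_time \<Delta> j"
    unfolding arrives_when_free_def Suc
    using departure_time_mono[of l _ k \<Delta>, OF assms] by (force simp: less_Suc_eq_le)
  also have "\<dots> \<longleftrightarrow> waiting_time \<Delta> l j = 0"
    by (auto simp: Suc departure_time_def arrival_time_def algebra_simps max_def)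
  finally show ?thesis .
qed

text \<open>
  The service side of a D/G/1 queue: the loading times are independent and share a common, but
  otherwise arbitrary, distribution on the nonnegative reals with mean \<open>Lbar\<close> and standard
  deviation \<open>\<sigma>\<close>. The degenerate case \<open>\<sigma> = 0\<close> is included.
\<close>

locale dg1_queue = prob_space M for M :: "'a measure" +
  fixes L :: "nat \<Rightarrow> 'a \<Rightarrow> real" and Lbar \<sigma> :: real
  assumes indep: "indep_vars (\<lambda>_. borel) L UNIV"
    and identically_distributed: "\<And>i j. distr M borel (L i) = distr M borel (L j)"
    and nonneg: "\<And>j. AE \<omega> in M. 0 \<le> L j \<omega>"
    and integrable: "\<And>j. integrable M (L j)"
    and square_integrable: "\<And>j. integrable M (\<lambda>\<omega>. (L j \<omega>)\<^sup>2)"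
    and mean: "\<And>j. expectation (L j) = Lbar"
    and mean_pos: "0 < Lbar"
    and variance: "\<And>j. variance (L j) = \<sigma>\<^sup>2"
    and sd_nonneg: "0 \<le> \<sigma>"

end

theory Submission imports Defs begin

text \<open>
  Write \<open>W\<^sub>j\<close> for the waiting time of truck \<open>j\<close> and \<open>a = \<Delta> - Lbar = \<sigma> \<cdot> sqrt ((1 - \<epsilon>) / \<epsilon>)\<close> for the
  slack. Cantelli's inequality bounds \<open>P(L\<^sub>j > \<Delta>)\<close> by \<open>\<sigma>\<^sup>2 / (\<sigma>\<^sup>2 + a\<^sup>2) = \<epsilon>\<close>, but this alone says
  nothing about a truck that waits because of a backlog built up earlier. The point of the proof
  is that the very same bound holds for \<open>P(W\<^sub>j > 0)\<close>, for every \<open>j\<close>.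

  Let \<open>I\<^sub>j = max 0 (\<Delta> - W\<^sub>j - L\<^sub>j)\<close> be the idle time of the loader before truck \<open>j + 1\<close> arrives. Then
  \<open>W\<^sub>j\<^sub>+\<^sub>1\<close> and \<open>I\<^sub>j\<close> are the positive and the negative part of \<open>W\<^sub>j + L\<^sub>j - \<Delta>\<close>, so that
  \<open>W\<^sub>j\<^sub>+\<^sub>1 - I\<^sub>j = W\<^sub>j + L\<^sub>j - \<Delta>\<close> and \<open>W\<^sub>j\<^sub>+\<^sub>1\<^sup>2 + I\<^sub>j\<^sup>2 = (W\<^sub>j + L\<^sub>j - \<Delta>)\<^sup>2\<close>. Take expectations and use two
  facts: \<open>W\<^sub>j\<close> is independent of \<open>L\<^sub>j\<close>, and the first two moments of \<open>W\<^sub>j\<close> increase with \<open>j\<close>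
  (\<open>expectation_waiting_time_mono\<close>). The result is
  \<open>E I\<^sub>j \<ge> a\<close> and \<open>E I\<^sub>j\<^sup>2 \<le> \<sigma>\<^sup>2 + a\<^sup>2 - 2 a E W\<^sub>j \<le> \<sigma>\<^sup>2 + a\<^sup>2\<close>.
  A second moment bound (\<open>second_moment_lower_bound\<close>) now gives
  \<open>P(I\<^sub>j > 0) \<ge> a\<^sup>2 / (\<sigma>\<^sup>2 + a\<^sup>2) = 1 - \<epsilon>\<close>, and \<open>I\<^sub>j > 0\<close> forces \<open>W\<^sub>j\<^sub>+\<^sub>1 = 0\<close>.

  For almost surely nonnegative loading times, not waiting is the same as finding the loader free,
  which is the second claim. The first one follows from it, because a loading time \<open>L\<^sub>j > \<Delta>\<close> makes
  truck \<open>j + 1\<close> wait.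
\<close>

section \<open>A second moment bound\<close>

text \<open>
  For every \<open>u\<close>, the parabola \<open>2 u x - u\<^sup>2 x\<^sup>2 = 1 - (1 - u x)\<^sup>2\<close> lies below the indicator of \<open>x > 0\<close>
  on the nonnegative half line. Integrating it with the best choice \<open>u = a / m\<close> gives the bound.
\<close>

lemma (in prob_space) second_moment_lower_bound:
  fixes Y :: "'a \<Rightarrow> real"
  assumes int: "integrable M Y" and int2: "integrable M (\<lambda>\<omega>. (Y \<omega>)\<^sup>2)"
    and nonneg: "\<And>\<omega>. 0 \<le> Y \<omega>"
    and first: "a \<le> expectation Y" and second: "expectation (\<lambda>\<omega>. (Y \<omega>)\<^sup>2) \<le> m"
    and "0 < a" and "0 < m"
  shows "a\<^sup>2 / m \<le> prob {\<omega> \<in> space M. 0 < Y \<omega>}"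
proof -
  define u where "u = a / m"
  have [measurable]: "Y \<in> borel_measurable M"
    using int by simp
  have "a\<^sup>2 / m = 2 * u * a - u\<^sup>2 * m"
    using \<open>0 < m\<close> by (simp add: u_def field_simps power2_eq_square)
  also have "\<dots> \<le> 2 * u * expectation Y - u\<^sup>2 * expectation (\<lambda>\<omega>. (Y \<omega>)\<^sup>2)"
    using assms by (intro diff_mono mult_left_mono) (auto simp: u_def)
  also have "\<dots> = expectation (\<lambda>\<omega>. 2 * u * Y \<omega> - u\<^sup>2 * (Y \<omega>)\<^sup>2)"
    using int int2 by simp
  also have "\<dots> \<le> expectation (indicator {\<omega> \<in> space M. 0 < Y \<omega>})"
  proof (rule integral_mono)
    fix \<omega> assume "\<omega> \<in> space M"
    have "0 \<le> (1 - u * Y \<omega>)\<^sup>2" by simp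
    then have "2 * u * Y \<omega> - u\<^sup>2 * (Y \<omega>)\<^sup>2 \<le> 1"
      by (simp add: power2_eq_square algebra_simps)
    then show "2 * u * Y \<omega> - u\<^sup>2 * (Y \<omega>)\<^sup>2 \<le> indicator {\<omega> \<in> space M. 0 < Y \<omega>} \<omega>"
      using nonneg[of \<omega>] \<open>\<omega> \<in> space M\<close> by (auto simp: indicator_def)
  qed (use int int2 in \<open>auto intro!: integrable_real_indicator simp: emeasure_eq_measure\<close>)
  finally show ?thesis by simp
qed

section \<open>Lindley's recursion along a single realisation\<close>

lemma waiting_time_nonneg: "0 \<le> waiting_time \<Delta> l j"
  by (cases j) auto

lemma waiting_time_cong:
  assumes "\<And>i. i < j \<Longrightarrow> l i = l' i"
  shows "waiting_time \<Delta> l j = waiting_time \<Delta> l' j"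
  using assms by (induction j) auto

text \<open>
  Deleting truck \<open>0\<close> shortens every wait: the recursion is monotone in its starting value, and the
  queue behind truck \<open>0\<close> starts with a wait that is at least \<open>0\<close>.
\<close>

lemma waiting_time_shift_le:
  "waiting_time \<Delta> (\<lambda>i. l (Suc i)) j \<le> waiting_time \<Delta> l (Suc j)"
  by (induction j) auto

lemma waiting_time_measurable:
  assumes "\<And>i. i < j \<Longrightarrow> i \<in> J"
  shows "(\<lambda>l. waiting_time \<Delta> l j) \<in> borel_measurable (PiM J (\<lambda>_. borel))"
  using assms
proof (induction j)
  case (Suc j)
  have [measurable]: "(\<lambda>l. waiting_time \<Delta> l j) \<in> borel_measurable (PiM J (\<lambda>_. borel))"
    using Suc by simp
  have [measurable]: "(\<lambda>l. l j) \<in> borel_measurable (PiM J (\<lambda>_. borel))"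
    using Suc.prems by (intro measurable_component_singleton) auto
  show ?case by simp
qed simp

section \<open>Distribution and moments of the waiting times\<close>

context dg1_queue
begin

abbreviation W :: "real \<Rightarrow> nat \<Rightarrow> 'a \<Rightarrow> real" where
  "W \<Delta> j \<omega> \<equiv> waiting_time \<Delta> (\<lambda>i. L i \<omega>) j"

lemma L_measurable [measurable]: "L j \<in> borel_measurable M"
  using integrable[of j] by simp

lemma W_measurable [measurable]: "W \<Delta> j \<in> borel_measurable M"
  by (induction j) auto

text \<open>
  Loading times that are independent and identically distributed form a stationary sequence.
\<close>

lemma distr_shift:
  "distr M (PiM UNIV (\<lambda>_. borel)) (\<lambda>\<omega> i. L (Suc i) \<omega>)
    = distr M (PiM UNIV (\<lambda>_. borel)) (\<lambda>\<omega> i. L i \<omega>)" (is "?l = ?r")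
proof -
  let ?B = "PiM UNIV (\<lambda>_::nat. borel :: real measure)"
  let ?D = "\<lambda>i. distr M borel (L i)"
  have r: "?r = PiM UNIV ?D"
    using indep_vars_iff_distr_eq_PiM'[of UNIV L "\<lambda>_. borel"] indep
    by (simp add: restrict_UNIV)
  have sets: "sets (PiM UNIV ?D) = sets ?B"
    by (intro sets_PiM_cong) auto
  have "?l = distr ?r ?B (\<lambda>l i. l (Suc i))"
    by (subst distr_distr) (auto simp: comp_def intro!: measurable_PiM_single')
  also have "\<dots> = distr (PiM UNIV ?D) (PiM UNIV (\<lambda>i. ?D (Suc i))) (\<lambda>l. \<lambda>i\<in>UNIV. l (Suc i))"
    unfolding r by (intro distr_cong sets_PiM_cong) (auto intro!: sets_PiM_cong)
  also have "\<dots> = PiM UNIV (\<lambda>i. ?D (Suc i))"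
    by (rule distr_PiM_reindex) (auto intro!: prob_space_distr)
  also have "\<dots> = PiM UNIV ?D"
    by (intro PiM_cong refl identically_distributed)
  finally show ?thesis using r by simp
qed

text \<open>
  The wait of truck \<open>j\<close> is a function of the loading times of the earlier trucks only.
\<close>

lemma indep_W_L: "indep_var borel (W \<Delta> j) borel (L j)"
proof -
  have "indep_var (PiM {..<j} (\<lambda>_. borel)) (\<lambda>\<omega>. \<lambda>i\<in>{..<j}. L i \<omega>)
      (PiM {j} (\<lambda>_. borel)) (\<lambda>\<omega>. \<lambda>i\<in>{j}. L i \<omega>)"
    using indep by (rule indep_var_restrict) auto
  then have "indep_var borel ((\<lambda>l. waiting_time \<Delta> l j) \<circ> (\<lambda>\<omega>. \<lambda>i\<in>{..<j}. L i \<omega>))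
      borel ((\<lambda>l. l j) \<circ> (\<lambda>\<omega>. \<lambda>i\<in>{j}. L i \<omega>))"
    by (rule indep_var_compose) (auto intro!: waiting_time_measurable)
  moreover have "(\<lambda>l. waiting_time \<Delta> l j) \<circ> (\<lambda>\<omega>. \<lambda>i\<in>{..<j}. L i \<omega>) = W \<Delta> j"
    by (auto simp: fun_eq_iff intro!: waiting_time_cong)
  moreover have "(\<lambda>l. l j) \<circ> (\<lambda>\<omega>. \<lambda>i\<in>{j}. L i \<omega>) = L j"
    by (auto simp: fun_eq_iff)
  ultimately show ?thesis by simp
qed

lemma W_square_integrable: "integrable M (\<lambda>\<omega>. (W \<Delta> j \<omega>)\<^sup>2)"
proof (induction j)
  case (Suc j)
  have "integrable M (\<lambda>\<omega>. 3 * (W \<Delta> j \<omega>)\<^sup>2 + 3 * (L j \<omega>)\<^sup>2 + 3 * \<Delta>\<^sup>2)"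
    using Suc square_integrable[of j] by simp
  then show ?case
  proof (rule Bochner_Integration.integrable_bound)
    have "(max 0 (x + y - z))\<^sup>2 \<le> 3 * x\<^sup>2 + 3 * y\<^sup>2 + 3 * z\<^sup>2" for x y z :: real
    proof -
      have "(max 0 (x + y - z))\<^sup>2 \<le> (x + y - z)\<^sup>2"
        by (auto simp: max_def)
      \<comment> \<open>the added squares cancel all mixed products\<close>
      also have "\<dots> \<le> (x + y - z)\<^sup>2 + (x - y)\<^sup>2 + (x + z)\<^sup>2 + (y + z)\<^sup>2"
        by simp
      also have "\<dots> = 3 * x\<^sup>2 + 3 * y\<^sup>2 + 3 * z\<^sup>2"
        by (simp add: power2_eq_square algebra_simps)
      finally show ?thesis .
    qed
    then show "AE \<omega> in M. norm ((W \<Delta> (Suc j) \<omega>)\<^sup>2)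
        \<le> norm (3 * (W \<Delta> j \<omega>)\<^sup>2 + 3 * (L j \<omega>)\<^sup>2 + 3 * \<Delta>\<^sup>2)"
      by simp
  qed measurable
qed simp

lemma W_integrable: "integrable M (W \<Delta> j)"
  by (rule square_integrable_imp_integrable[OF W_measurable W_square_integrable])

text \<open>
  Waiting times are stochastically increasing in \<open>j\<close>: truck \<open>j + 1\<close> waits at least as long as it
  would without truck \<open>0\<close>, and by stationarity that shorter wait has the distribution of \<open>W\<^sub>j\<close>.
  The exponents of interest are \<open>n = 1\<close> and \<open>n = 2\<close>.
\<close>

lemma expectation_waiting_time_mono:
  assumes int: "\<And>i. integrable M (\<lambda>\<omega>. (W \<Delta> i \<omega>) ^ n)"
  shows "expectation (\<lambda>\<omega>. (W \<Delta> j \<omega>) ^ n) \<le> expectation (\<lambda>\<omega>. (W \<Delta> (Suc j) \<omega>) ^ n)"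
proof -
  let ?B = "PiM UNIV (\<lambda>_::nat. borel :: real measure)"
  let ?g = "\<lambda>l. (waiting_time \<Delta> l j) ^ n"
  have g [measurable]: "?g \<in> borel_measurable ?B"
    using waiting_time_measurable[of j UNIV \<Delta>] by simp
  have L: "(\<lambda>\<omega> i. L i \<omega>) \<in> measurable M ?B" "(\<lambda>\<omega> i. L (Suc i) \<omega>) \<in> measurable M ?B"
    by (auto intro!: measurable_PiM_single')
  have "integrable (distr M ?B (\<lambda>\<omega> i. L i \<omega>)) ?g"
    using int[of j] by (simp add: integrable_distr_eq L)
  then have int': "integrable M (\<lambda>\<omega>. ?g (\<lambda>i. L (Suc i) \<omega>))"
    unfolding distr_shift[symmetric] by (simp add: integrable_distr_eq L)
  have "expectation (\<lambda>\<omega>. (W \<Delta> j \<omega>) ^ n) = integral\<^sup>L (distr M ?B (\<lambda>\<omega> i. L i \<omega>)) ?g"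
    by (simp add: integral_distr L)
  also have "\<dots> = expectation (\<lambda>\<omega>. ?g (\<lambda>i. L (Suc i) \<omega>))"
    unfolding distr_shift[symmetric] by (simp add: integral_distr L)
  also have "\<dots> \<le> expectation (\<lambda>\<omega>. (W \<Delta> (Suc j) \<omega>) ^ n)"
    using int' int
    by (rule integral_mono) (intro power_mono waiting_time_shift_le waiting_time_nonneg)
  finally show ?thesis .
qed

section \<open>The probability of not waiting\<close>

lemma prob_no_wait_ge:
  assumes slack: "Lbar < \<Delta>"
  shows "(\<Delta> - Lbar)\<^sup>2 / (\<sigma>\<^sup>2 + (\<Delta> - Lbar)\<^sup>2) \<le> prob {\<omega> \<in> space M. W \<Delta> j \<omega> = 0}"
proof (cases j)
  case 0
  then show ?thesis using slack by (simp add: prob_space divide_le_eq_1 add_nonneg_pos)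
next
  case (Suc k)
  define a where "a = \<Delta> - Lbar"
  define I where "I \<omega> = max 0 (\<Delta> - W \<Delta> k \<omega> - L k \<omega>)" for \<omega>
  have "0 < a" using slack by (simp add: a_def)
  note ints [simp] = integrable[of k] square_integrable[of k] W_integrable W_square_integrable
  have prod [simp]: "integrable M (\<lambda>\<omega>. W \<Delta> k \<omega> * L k \<omega>)"
    and eprod: "expectation (\<lambda>\<omega>. W \<Delta> k \<omega> * L k \<omega>) = expectation (W \<Delta> k) * Lbar"
    using indep_var_integrable[OF indep_W_L] indep_var_lebesgue_integral[OF indep_W_L]
    by (simp_all add: mean)
  have EL2: "expectation (\<lambda>\<omega>. (L k \<omega>)\<^sup>2) = \<sigma>\<^sup>2 + Lbar\<^sup>2"
    using variance_eq[of "L k"] variance[of k] mean[of k] by simp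
  have I: "I = (\<lambda>\<omega>. W \<Delta> (Suc k) \<omega> - W \<Delta> k \<omega> - L k \<omega> + \<Delta>)"
    by (auto simp: I_def fun_eq_iff max_def)
  have I2: "(\<lambda>\<omega>. (I \<omega>)\<^sup>2) = (\<lambda>\<omega>. (W \<Delta> k \<omega>)\<^sup>2 - (W \<Delta> (Suc k) \<omega>)\<^sup>2 + (L k \<omega>)\<^sup>2
      + 2 * (W \<Delta> k \<omega> * L k \<omega>) - 2 * \<Delta> * W \<Delta> k \<omega> - 2 * \<Delta> * L k \<omega> + \<Delta>\<^sup>2)"
    by (auto simp: I_def fun_eq_iff max_def power2_eq_square algebra_simps)
  have int_I: "integrable M I"
    unfolding I by (simp del: waiting_time.simps)
  have int_I2: "integrable M (\<lambda>\<omega>. (I \<omega>)\<^sup>2)"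
    unfolding I2 by (simp del: waiting_time.simps)
  have EI: "a \<le> expectation I"
    using expectation_waiting_time_mono[of \<Delta> 1 k]
    unfolding I by (simp add: a_def mean prob_space del: waiting_time.simps)
  have "expectation (\<lambda>\<omega>. (I \<omega>)\<^sup>2)
      = expectation (\<lambda>\<omega>. (W \<Delta> k \<omega>)\<^sup>2) - expectation (\<lambda>\<omega>. (W \<Delta> (Suc k) \<omega>)\<^sup>2)
        + (\<sigma>\<^sup>2 + a\<^sup>2) - 2 * a * expectation (W \<Delta> k)"
    unfolding I2 by (simp add: mean eprod EL2 prob_space del: waiting_time.simps)
      (simp add: a_def power2_eq_square algebra_simps)
  moreover have "0 \<le> 2 * a * expectation (W \<Delta> k)"
    using \<open>0 < a\<close> by (intro mult_nonneg_nonneg Bochner_Integration.integral_nonneg waiting_time_nonneg) auto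
  ultimately have EI2: "expectation (\<lambda>\<omega>. (I \<omega>)\<^sup>2) \<le> \<sigma>\<^sup>2 + a\<^sup>2"
    using expectation_waiting_time_mono[of \<Delta> 2 k] by (simp del: waiting_time.simps)
  have "a\<^sup>2 / (\<sigma>\<^sup>2 + a\<^sup>2) \<le> prob {\<omega> \<in> space M. 0 < I \<omega>}"
    using int_I int_I2 _ EI EI2 \<open>0 < a\<close>
    by (rule second_moment_lower_bound) (use \<open>0 < a\<close> in \<open>auto simp: I_def add_nonneg_pos\<close>)
  also have "\<dots> \<le> prob {\<omega> \<in> space M. W \<Delta> (Suc k) \<omega> = 0}"
    by (intro finite_measure_mono) (auto simp: I_def max_def)
  finally show ?thesis unfolding a_def Suc .
qed

text \<open>
  Without slack the bound above is void. This happens only for \<open>\<sigma> = 0\<close>, when all loading times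
  equal their mean and no queue ever forms.
\<close>

lemma AE_no_wait_deterministic:
  assumes "\<sigma> = 0"
  shows "AE \<omega> in M. W Lbar j \<omega> = 0"
proof -
  have "AE \<omega> in M. L i \<omega> = Lbar" for i
  proof -
    have "integrable M (\<lambda>\<omega>. (L i \<omega> - Lbar)\<^sup>2)"
      using integrable[of i] square_integrable[of i] by (simp add: power2_diff)
    moreover have "expectation (\<lambda>\<omega>. (L i \<omega> - Lbar)\<^sup>2) = 0"
      using variance[of i] mean[of i] assms by simp
    ultimately have "AE \<omega> in M. (L i \<omega> - Lbar)\<^sup>2 = 0"
      using integral_nonneg_eq_0_iff_AE[of M "\<lambda>\<omega>. (L i \<omega> - Lbar)\<^sup>2"] by simp
    then show ?thesis by simp
  qed
  then have "AE \<omega> in M. \<forall>i. L i \<omega> = Lbar"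
    by (simp add: AE_all_countable)
  then show ?thesis
  proof eventually_elim
    case (elim \<omega>)
    then show "W Lbar j \<omega> = 0" by (induction j) auto
  qed
qed

lemma prob_no_wait_ge_tolerance:
  assumes "0 < \<epsilon>" "\<epsilon> < 1" and \<Delta>: "\<Delta> = Lbar + \<sigma> * sqrt ((1 - \<epsilon>) / \<epsilon>)"
  shows "1 - \<epsilon> \<le> prob {\<omega> \<in> space M. W \<Delta> j \<omega> = 0}"
proof (cases "\<sigma> = 0")
  case True
  then have "prob {\<omega> \<in> space M. W \<Delta> j \<omega> = 0} = 1"
    using AE_no_wait_deterministic[of j] by (subst prob_Collect_eq_1) (auto simp: \<Delta>)
  then show ?thesis using assms by simp
next
  case False
  then have "0 < \<sigma>" using sd_nonneg by simp
  have "(\<Delta> - Lbar)\<^sup>2 = \<sigma>\<^sup>2 * ((1 - \<epsilon>) / \<epsilon>)"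
    using assms by (simp add: power_mult_distrib)
  then have "(\<Delta> - Lbar)\<^sup>2 / (\<sigma>\<^sup>2 + (\<Delta> - Lbar)\<^sup>2) = 1 - \<epsilon>"
    using \<open>0 < \<sigma>\<close> assms by (simp add: field_simps)
  moreover have "Lbar < \<Delta>"
    using \<open>0 < \<sigma>\<close> assms by simp
  ultimately show ?thesis
    using prob_no_wait_ge[of \<Delta> j] by linarith
qed

lemma prob_arrives_when_free:
  "prob {\<omega> \<in> space M. arrives_when_free \<Delta> (\<lambda>i. L i \<omega>) j} = prob {\<omega> \<in> space M. W \<Delta> j \<omega> = 0}"
proof (rule finite_measure_eq_AE)
  have "AE \<omega> in M. \<forall>i. 0 \<le> L i \<omega>"
    using nonneg by (simp add: AE_all_countable)
  then show "AE \<omega> in M. \<omega> \<in> {\<omega> \<in> space M. arrives_when_free \<Delta> (\<lambda>i. L i \<omega>) j}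
      \<longleftrightarrow> \<omega> \<in> {\<omega> \<in> space M. W \<Delta> j \<omega> = 0}"
  proof eventually_elim
    case (elim \<omega>)
    then show ?case using arrives_when_free_iff[of "\<lambda>i. L i \<omega>" \<Delta> j] by blast
  qed
  show "{\<omega> \<in> space M. arrives_when_free \<Delta> (\<lambda>i. L i \<omega>) j} \<in> events"
    unfolding arrives_when_free_def departure_time_def by measurable
  show "{\<omega> \<in> space M. W \<Delta> j \<omega> = 0} \<in> events"
    by measurable
qed

lemma prob_long_loading_le:
  "prob {\<omega> \<in> space M. \<Delta> < L j \<omega>} \<le> 1 - prob {\<omega> \<in> space M. W \<Delta> (Suc j) \<omega> = 0}"
proof -
  have "prob {\<omega> \<in> space M. \<Delta> < L j \<omega>} \<le> prob {\<omega> \<in> space M. W \<Delta> (Suc j) \<omega> \<noteq> 0}"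
  proof (rule finite_measure_mono)
    show "{\<omega> \<in> space M. \<Delta> < L j \<omega>} \<subseteq> {\<omega> \<in> space M. W \<Delta> (Suc j) \<omega> \<noteq> 0}"
    proof safe
      fix \<omega> assume "\<Delta> < L j \<omega>" "W \<Delta> (Suc j) \<omega> = 0"
      then show False
        using waiting_time_nonneg[of \<Delta> "\<lambda>i. L i \<omega>" j] by (simp add: max_def split: if_splits)
    qed
  qed measurable
  also have "\<dots> = 1 - prob {\<omega> \<in> space M. W \<Delta> (Suc j) \<omega> = 0}"
    by (rule prob_neg) measurable
  finally show ?thesis .
qed

end

theorem corollary1:
  fixes M :: "'a measure" and L :: "nat \<Rightarrow> 'a \<Rightarrow> real" and Lbar \<sigma> \<epsilon> \<Delta> :: real
  assumes "dg1_queue M L Lbar \<sigma>"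
    and "0 < \<epsilon>" and "\<epsilon> < 1"
    and "\<Delta> = Lbar + \<sigma> * sqrt ((1 - \<epsilon>) / \<epsilon>)"
  shows "(\<forall>j. measure M {\<omega> \<in> space M. L j \<omega> > \<Delta>} \<le> \<epsilon>) \<and>
    (\<forall>j. measure M {\<omega> \<in> space M. arrives_when_free \<Delta> (\<lambda>i. L i \<omega>) j} \<ge> 1 - \<epsilon>)"
proof -
  interpret dg1_queue M L Lbar \<sigma> by fact
  note no_wait = prob_no_wait_ge_tolerance[OF assms(2-4)]
  show ?thesis
  proof (intro conjI allI)
    fix j
    show "prob {\<omega> \<in> space M. L j \<omega> > \<Delta>} \<le> \<epsilon>"
      using prob_long_loading_le[of \<Delta> j] no_wait[of "Suc j"] by linarith
    show "prob {\<omega> \<in> space M. arrives_when_free \<Delta> (\<lambda>i. L i \<omega>) j} \<ge> 1 - \<epsilon>"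
      unfolding prob_arrives_when_free by (rule no_wait)
  qed
qed

end
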